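(* Let $\mathscr{H}$ be a complex Hilbert space and let $B,C \in\mathbb{B}(\mathscr{H})$. Then the following inequalities hold: (i) $w_e(B,C) \geq \max\{ w(B),w(C)\}$. (ii) $w_e(B,C) \geq \frac{1}{\sqrt{2}}w \left(B+e^{i\theta}C\right)$ for all $\theta \in \mathbb{R}$. (iii) $w_e(B,C) \geq \sqrt{ \frac12 w\left(B^2+e^{i\theta}C^2\right)+\frac12 \left| w^2(B)-w^2(C)\right| }$ for all $\theta \in \mathbb{R}$. (iv) $w_e(B,C) \geq \sqrt{\frac12 w\left(BC+CB\right)}$.
   Context: $\mathbb{B}(\mathscr{H})$ denotes the bounded linear operators on $\mathscr{H}$. The numerical radius is $w(T)=\sup\{|\langle Tx,x\rangle| : x\in\mathscr{H},\ \|x\|=1\}$, and $w^2(\cdot)$ means $(w(\cdot))^2$. The Euclidean operator radius of $B,C$ is $w_e(B,C)=\sup\left\{\sqrt{|\langle Bx,x\rangle|^2+|\langle Cx,x\rangle|^2} : x\in\mathscr{H},\ \|x\|=1\right\}$. *)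

theory Defs
  imports "HOL-Analysis.Analysis"
begin

class complex_inner = real_normed_vector +
  fixes scaleC :: "complex \<Rightarrow> 'a \<Rightarrow> 'a"  (infixr "*\<^sub>C" 75)
    and cinner :: "'a \<Rightarrow> 'a \<Rightarrow> complex"
  assumes scaleC_add_right: "a *\<^sub>C (x + y) = a *\<^sub>C x + a *\<^sub>C y"
    and scaleC_add_left: "(a + b) *\<^sub>C x = a *\<^sub>C x + b *\<^sub>C x"
    and scaleC_scaleC: "a *\<^sub>C (b *\<^sub>C x) = (a * b) *\<^sub>C x"
    and scaleC_of_real: "complex_of_real r *\<^sub>C x = scaleR r x"
    and cinner_commute: "cinner x y = cnj (cinner y x)"
    and cinner_add_left: "cinner (x + y) z = cinner x z + cinner y z"
    and cinner_scaleC_left: "cinner (a *\<^sub>C x) y = a * cinner x y"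
    and cinner_ge_zero: "0 \<le> Re (cinner x x)"
    and cinner_eq_zero_iff: "cinner x x = 0 \<longleftrightarrow> x = 0"
    and norm_eq_sqrt_cinner: "norm x = sqrt (Re (cinner x x))"

class chilbert_space = complex_inner + complete_space

instantiation complex :: chilbert_space
begin

definition scaleC_complex :: "complex \<Rightarrow> complex \<Rightarrow> complex" where
  "scaleC_complex a x = a * x"

definition cinner_complex :: "complex \<Rightarrow> complex \<Rightarrow> complex" where
  "cinner_complex x y = x * cnj y"

instance
proof
  fix a b x y z :: complex and r :: real
  show "a *\<^sub>C (x + y) = a *\<^sub>C x + a *\<^sub>C y"
    by (simp add: scaleC_complex_def distrib_left)
  show "(a + b) *\<^sub>C x = a *\<^sub>C x + b *\<^sub>C x"
    by (simp add: scaleC_complex_def distrib_right)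
  show "a *\<^sub>C (b *\<^sub>C x) = (a * b) *\<^sub>C x"
    by (simp add: scaleC_complex_def)
  show "complex_of_real r *\<^sub>C x = r *\<^sub>R x"
    by (simp add: scaleC_complex_def scaleR_conv_of_real)
  show "cinner x y = cnj (cinner y x)"
    by (simp add: cinner_complex_def)
  show "cinner (x + y) z = cinner x z + cinner y z"
    by (simp add: cinner_complex_def distrib_right)
  show "cinner (a *\<^sub>C x) y = a * cinner x y"
    by (simp add: cinner_complex_def scaleC_complex_def)
  show "0 \<le> Re (cinner x x)"
    by (simp add: cinner_complex_def)
  show "cinner x x = 0 \<longleftrightarrow> x = 0"
    by (simp add: cinner_complex_def)
  show "norm x = sqrt (Re (cinner x x))"
    by (simp add: cinner_complex_def cmod_def power2_eq_square)
qed

end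

text \<open>\<^const>\<open>bounded_linear\<close> refers to the underlying real vector space, so complex
  homogeneity is required separately.\<close>

definition bounded_clinear :: "('a::complex_inner \<Rightarrow> 'a) \<Rightarrow> bool" where
  "bounded_clinear T \<longleftrightarrow> bounded_linear T \<and> (\<forall>a x. T (a *\<^sub>C x) = a *\<^sub>C T x)"

text \<open>In the zero space there are no unit vectors. The supremum of the empty set, taken among
  the nonnegative reals, is then 0, whereas \<^term>\<open>Sup {} :: real\<close> is unspecified.
  For bounded operators the sets below are bounded above.\<close>

definition numerical_radius :: "('a::complex_inner \<Rightarrow> 'a) \<Rightarrow> real" where
  "numerical_radius T =
    (if \<exists>x::'a. norm x = 1
     then SUP x\<in>{x. norm x = 1}. cmod (cinner (T x) x)
     else 0)"

definition euclidean_operator_radius ::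
    "('a::complex_inner \<Rightarrow> 'a) \<Rightarrow> ('a \<Rightarrow> 'a) \<Rightarrow> real" where
  "euclidean_operator_radius B C =
    (if \<exists>x::'a. norm x = 1
     then SUP x\<in>{x. norm x = 1}. sqrt ((cmod (cinner (B x) x))\<^sup>2 + (cmod (cinner (C x) x))\<^sup>2)
     else 0)"

end

(* The only operator-theoretic input is the case n = 2 of the power inequality, w(T^2) <= w(T)^2.
   It comes from the factorisation K^2 - T^2 = (K - T)(K + T): with u = (K + T)x and v = (K - T)x,
     2K <(K^2 - T^2)x, x> = <(K - T)u, u> + <(K + T)v, v>,
   and the right-hand side has nonnegative real part as soon as w(T) <= K; a rotation of T turns
   the real part of <T^2 x, x> into its modulus.
   The third bound uses max(p,q) = (p + q)/2 + |p - q|/2 with p = w(B)^2 and q = w(C)^2; the last one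
   applies the power inequality to B + C and B - C, as (B + C)^2 - (B - C)^2 = 2(BC + CB). *)
theory Submission
  imports Defs
begin

section \<open>Sesquilinearity, complex homogeneity of the norm, and Cauchy-Schwarz\<close>

lemma cinner_add_right: "cinner x (y + z) = cinner x y + cinner x (z::'a::complex_inner)"
  by (metis cinner_add_left cinner_commute complex_cnj_add)

lemma cinner_scaleC_right: "cinner x (a *\<^sub>C y) = cnj a * cinner x (y::'a::complex_inner)"
  by (metis cinner_commute cinner_scaleC_left complex_cnj_mult)

lemma cinner_diff_left: "cinner (x - y) z = cinner x z - cinner y (z::'a::complex_inner)"
  by (metis add_diff_cancel_right' cinner_add_left diff_add_cancel)

lemma cinner_scaleR_left: "cinner (r *\<^sub>R x) y = complex_of_real r * cinner x (y::'a::complex_inner)"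
  by (metis cinner_scaleC_left scaleC_of_real)

lemma cinner_scaleR_right: "cinner x (r *\<^sub>R y) = complex_of_real r * cinner x (y::'a::complex_inner)"
  by (metis cinner_scaleC_right scaleC_of_real complex_cnj_complex_of_real)

lemma cinner_self_eq_norm: "cinner x x = complex_of_real ((norm (x::'a::complex_inner))\<^sup>2)"
proof -
  have "Im (cinner x x) = 0"
    using cinner_commute[of x x] by (simp add: complex_eq_iff)
  then show ?thesis
    by (simp add: complex_eq_iff norm_eq_sqrt_cinner cinner_ge_zero)
qed

lemma norm_scaleC: "norm (a *\<^sub>C x) = cmod a * norm (x::'a::complex_inner)"
proof -
  have "complex_of_real ((norm (a *\<^sub>C x))\<^sup>2) = (a * cnj a) * cinner x x"
    by (simp only: cinner_self_eq_norm[symmetric] cinner_scaleC_left cinner_scaleC_right ac_simps)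
  also have "\<dots> = complex_of_real ((cmod a * norm x)\<^sup>2)"
    by (simp add: cinner_self_eq_norm complex_norm_square[symmetric] power_mult_distrib)
  finally have "(norm (a *\<^sub>C x))\<^sup>2 = (cmod a * norm x)\<^sup>2"
    using of_real_eq_iff by blast
  then show ?thesis
    by simp
qed

text \<open>The phase is the conjugate of z divided by its modulus, or 1 if z is zero. Rotating by
  it upgrades bounds on real parts to bounds on moduli.\<close>

lemma exists_unit_mult_eq_norm: "\<exists>a. cmod a = 1 \<and> a * z = complex_of_real (cmod z)"
proof (cases "z = 0")
  case True
  then show ?thesis by (intro exI[of _ 1]) simp
next
  case False
  then show ?thesis
    by (intro exI[of _ "cnj z / cmod z"])
       (simp add: norm_divide mult.commute[of "cnj z"] complex_norm_square[symmetric]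
          power2_eq_square[of "complex_of_real (cmod z)"])
qed

text \<open>The triangle inequality is already an axiom of the normed space, so the usual order is
  reversed: Cauchy-Schwarz comes from expanding the square of \<open>norm (x + y)\<close> and
  comparing it with the square of \<open>norm x + norm y\<close>.\<close>

lemma Re_cinner_le_norm: "Re (cinner x y) \<le> norm x * norm (y::'a::complex_inner)"
proof -
  have "cinner (x + y) (x + y) = cinner x x + cinner y y + (cinner x y + cnj (cinner x y))"
    by (simp add: cinner_add_left cinner_add_right cinner_commute[of y x, symmetric])
  then have "(norm (x + y))\<^sup>2 = (norm x)\<^sup>2 + (norm y)\<^sup>2 + 2 * Re (cinner x y)"
    by (simp add: cinner_self_eq_norm complex_eq_iff del: of_real_power)
  moreover have "(norm (x + y))\<^sup>2 \<le> (norm x + norm y)\<^sup>2"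
    by (simp add: norm_triangle_ineq power_mono)
  ultimately show ?thesis
    by (simp add: power2_sum)
qed

lemma cmod_cinner_le_norm: "cmod (cinner x y) \<le> norm x * norm (y::'a::complex_inner)"
proof -
  obtain a where a: "cmod a = 1" "a * cinner x y = complex_of_real (cmod (cinner x y))"
    using exists_unit_mult_eq_norm by blast
  have "cmod (cinner x y) = Re (cinner (a *\<^sub>C x) y)"
    by (simp add: cinner_scaleC_left a)
  also have "\<dots> \<le> norm x * norm y"
    using Re_cinner_le_norm[of "a *\<^sub>C x" y] by (simp add: norm_scaleC a)
  finally show ?thesis .
qed

section \<open>Bounded complex-linear operators and the two radii as suprema\<close>

lemma bounded_clinear_add:
  "bounded_clinear S \<Longrightarrow> bounded_clinear T \<Longrightarrow> bounded_clinear (\<lambda>x. S x + T x)"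
  by (simp add: bounded_clinear_def bounded_linear_add scaleC_add_right)

lemma bounded_clinear_scaleC:
  assumes "bounded_clinear T"
  shows "bounded_clinear (\<lambda>x. a *\<^sub>C T x)"
proof -
  have "bounded_linear (\<lambda>x::'a. a *\<^sub>C x)"
    by (rule bounded_linear_intro[where K="cmod a"])
       (simp_all add: scaleC_add_right norm_scaleC scaleC_scaleC scaleC_of_real[symmetric] mult.commute)
  from bounded_linear_compose[OF this] show ?thesis
    using assms by (auto simp: bounded_clinear_def scaleC_scaleC mult.commute)
qed

lemma bounded_clinear_diff:
  assumes "bounded_clinear S" and "bounded_clinear T"
  shows "bounded_clinear (\<lambda>x. S x - T x)"
  using bounded_clinear_add[OF assms(1) bounded_clinear_scaleC[OF assms(2), of "complex_of_real (-1)"]]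
  by (simp add: scaleC_of_real del: of_real_minus)

text \<open>A real supremum dominates its set only when that set is bounded above. Here
  Cauchy-Schwarz turns any operator-norm bound into a bound on the quadratic form.\<close>

lemma bdd_above_cmod_cinner:
  assumes "bounded_clinear T"
  shows "bdd_above ((\<lambda>x. cmod (cinner (T x) x)) ` {x. norm x = 1})"
proof -
  obtain K where K: "\<And>x. norm (T x) \<le> norm x * K"
    using assms unfolding bounded_clinear_def bounded_linear_def bounded_linear_axioms_def by blast
  show ?thesis
  proof (rule bdd_aboveI2)
    fix x :: 'a assume "x \<in> {x. norm x = 1}"
    then show "cmod (cinner (T x) x) \<le> K"
      using cmod_cinner_le_norm[of "T x" x] K[of x] by simp
  qed
qed

lemma cmod_cinner_le_numerical_radius:
  assumes "bounded_clinear T" "norm x = 1"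
  shows "cmod (cinner (T x) x) \<le> numerical_radius T"
  using assms bdd_above_cmod_cinner[OF assms(1)]
  by (auto simp: numerical_radius_def intro: cSUP_upper)

text \<open>The nonnegativity of K covers the zero space, where there are no unit vectors and the
  radius is 0 by default.\<close>

lemma numerical_radius_least:
  assumes "0 \<le> K" "\<And>x. norm x = 1 \<Longrightarrow> cmod (cinner (T x) x) \<le> K"
  shows "numerical_radius T \<le> K"
  using assms by (auto simp: numerical_radius_def intro!: cSUP_least)

lemma numerical_radius_nonneg:
  assumes "bounded_clinear T"
  shows "0 \<le> numerical_radius T"
proof (cases "\<exists>x::'a. norm x = 1")
  case True
  then show ?thesis
    using cmod_cinner_le_numerical_radius[OF assms] norm_ge_zero order_trans by blast
qed (simp add: numerical_radius_def)

lemma le_euclidean_operator_radius: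
  assumes "bounded_clinear B" "bounded_clinear C" "norm x = 1"
  shows "sqrt ((cmod (cinner (B x) x))\<^sup>2 + (cmod (cinner (C x) x))\<^sup>2) \<le> euclidean_operator_radius B C"
proof -
  let ?f = "\<lambda>x. sqrt ((cmod (cinner (B x) x))\<^sup>2 + (cmod (cinner (C x) x))\<^sup>2)"
  \<comment> \<open>A sum of two squares has square root at most the sum of the two moduli, so the
    numerical radii give a common bound.\<close>
  have "bdd_above (?f ` {x. norm x = 1})"
  proof (rule bdd_aboveI2)
    fix x :: 'a assume "x \<in> {x. norm x = 1}"
    then show "?f x \<le> numerical_radius B + numerical_radius C"
      using sqrt_sum_squares_le_sum[of "cmod (cinner (B x) x)" "cmod (cinner (C x) x)"]
        cmod_cinner_le_numerical_radius[OF assms(1), of x]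
        cmod_cinner_le_numerical_radius[OF assms(2), of x] by simp
  qed
  with assms(3) show ?thesis
    by (auto simp: euclidean_operator_radius_def intro: cSUP_upper)
qed

lemma euclidean_operator_radius_nonneg:
  fixes B C :: "'a::complex_inner \<Rightarrow> 'a"
  assumes "bounded_clinear B" "bounded_clinear C"
  shows "0 \<le> euclidean_operator_radius B C"
proof (cases "\<exists>x::'a. norm x = 1")
  case True
  then obtain x :: 'a where "norm x = 1" by blast
  then show ?thesis
    using le_euclidean_operator_radius[OF assms] real_sqrt_ge_zero order_trans
    by (metis sum_power2_ge_zero)
qed (simp add: euclidean_operator_radius_def)

lemma euclidean_operator_radius_commute:
  "euclidean_operator_radius B C = euclidean_operator_radius C B"
  by (simp add: euclidean_operator_radius_def add.commute)

lemma numerical_radius_le_euclidean_operator_radius: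
  assumes "bounded_clinear B" "bounded_clinear C"
  shows "numerical_radius B \<le> euclidean_operator_radius B C"
proof (rule numerical_radius_least[OF euclidean_operator_radius_nonneg[OF assms]])
  fix x :: 'a assume "norm x = 1"
  then show "cmod (cinner (B x) x) \<le> euclidean_operator_radius B C"
    using le_euclidean_operator_radius[OF assms] by (meson order_trans real_sqrt_sum_squares_ge1)
qed

section \<open>The power inequality for squares: real part first, then modulus\<close>

lemma Re_cinner_square_le:
  assumes T: "bounded_clinear T"
    and K: "0 < K" "\<And>x. norm x = 1 \<Longrightarrow> cmod (cinner (T x) x) \<le> K"
    and x: "norm x = 1"
  shows "Re (cinner (T (T x)) x) \<le> K\<^sup>2"
proof -
  interpret T: bounded_linear T
    using T by (simp add: bounded_clinear_def)
  \<comment> \<open>The vectors u and v below are not normalised, so the bound on unit vectors is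
    first extended quadratically to all vectors.\<close>
  have *: "\<bar>Re (cinner (T y) y)\<bar> \<le> K * (norm y)\<^sup>2" for y
  proof (cases "y = 0")
    case False
    define z where "z = y /\<^sub>R norm y"
    have z: "norm z = 1" and y: "y = norm y *\<^sub>R z"
      using False by (auto simp: z_def)
    have "cinner (T y) y = complex_of_real ((norm y)\<^sup>2) * cinner (T z) z"
      by (subst (1 2) y) (simp add: T.scaleR cinner_scaleR_left cinner_scaleR_right power2_eq_square)
    then have "cmod (cinner (T y) y) = (norm y)\<^sup>2 * cmod (cinner (T z) z)"
      by (simp add: norm_mult norm_power)
    also have "\<dots> \<le> K * (norm y)\<^sup>2"
      using mult_left_mono[OF K(2)[OF z], of "(norm y)\<^sup>2"] by (simp add: mult.commute)
    finally show ?thesis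
      using abs_Re_le_cmod order_trans by blast
  qed (simp add: T.zero cinner_self_eq_norm)
  let ?u = "K *\<^sub>R x + T x" and ?v = "K *\<^sub>R x - T x"
  let ?D = "(K * K) *\<^sub>R x - T (T x)"
  \<comment> \<open>Since u + v = 2Kx, pairing D with u + v produces the factor 2K.\<close>
  have "2 * K * (K\<^sup>2 - Re (cinner (T (T x)) x)) = Re (cinner ?D (?u + ?v))"
    using x by (simp add: scaleR_2[symmetric] cinner_scaleR_right cinner_diff_left
        cinner_scaleR_left cinner_self_eq_norm power2_eq_square algebra_simps)
  also have "\<dots> = Re (cinner (K *\<^sub>R ?u - T ?u) ?u) + Re (cinner (K *\<^sub>R ?v + T ?v) ?v)"
  proof -
    \<comment> \<open>T commutes with real scalars, so D factors both as (K - T)u and as (K + T)v.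
      Each factorisation is paired with its own vector.\<close>
    have "K *\<^sub>R ?u - T ?u = ?D" "K *\<^sub>R ?v + T ?v = ?D"
      by (simp_all add: T.add T.diff T.scaleR algebra_simps)
    then show ?thesis
      by (simp only: cinner_add_right[of ?D ?u ?v] plus_complex.sel)
  qed
  also have "\<dots> \<ge> 0"
    using *[of ?u] *[of ?v]
    by (simp add: cinner_add_left cinner_diff_left cinner_scaleR_left cinner_self_eq_norm
        del: of_real_power)
  \<comment> \<open>Cancelling 2K is where K has to be strictly positive.\<close>
  finally show ?thesis
    using K(1) by (simp add: zero_le_mult_iff)
qed

lemma cmod_cinner_square_le:
  assumes T: "bounded_clinear T"
    and K: "0 \<le> K" "\<And>x. norm x = 1 \<Longrightarrow> cmod (cinner (T x) x) \<le> K"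
    and x: "norm x = 1"
  shows "cmod (cinner (T (T x)) x) \<le> K\<^sup>2"
\<comment> \<open>K may be 0 here, while the bound on the real part needs a positive constant. So
  that bound is used with \<open>sqrt c\<close> for every c above the square of K.\<close>
proof (rule dense_ge)
  fix c assume c: "K\<^sup>2 < c"
  then have c0: "0 < c"
    by (meson le_less_trans zero_le_power2)
  have Kc: "K \<le> sqrt c"
    using c by (simp add: real_le_rsqrt)
  obtain b where b: "cmod b = 1"
      "b * cinner (T (T x)) x = complex_of_real (cmod (cinner (T (T x)) x))"
    using exists_unit_mult_eq_norm by blast
  \<comment> \<open>Replacing T by aT multiplies its square by the square of a, so a has to be a
    square root of the desired phase b. As a is unimodular, aT satisfies the same bound as T on unit
    vectors.\<close>
  let ?a = "csqrt b"
  have a: "cmod ?a = 1" "?a * ?a = b"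
    using b(1) by (simp_all add: norm_csqrt power2_eq_square[symmetric])
  have "Re (cinner (?a *\<^sub>C T (?a *\<^sub>C T x)) x) \<le> (sqrt c)\<^sup>2"
    using c0 a K(2) Kc x
    by (intro Re_cinner_square_le[OF bounded_clinear_scaleC[OF T]])
       (auto simp: cinner_scaleC_left norm_mult intro: order_trans)
  moreover have "cinner (?a *\<^sub>C T (?a *\<^sub>C T x)) x = b * cinner (T (T x)) x"
    using T by (simp add: bounded_clinear_def scaleC_scaleC a(2) cinner_scaleC_left)
  ultimately show "cmod (cinner (T (T x)) x) \<le> c"
    using b(2) c0 by simp
qed

section \<open>Unimodular combinations of two quadratic forms, and the four lower bounds\<close>

lemma cmod_cinner_add_le_euclidean_operator_radius:
  assumes "bounded_clinear B" "bounded_clinear C" "cmod a = 1" "norm x = 1"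
  shows "cmod (cinner (B x) x + a * cinner (C x) x) \<le> sqrt 2 * euclidean_operator_radius B C"
proof -
  let ?b = "cmod (cinner (B x) x)" and ?c = "cmod (cinner (C x) x)"
  have "cmod (cinner (B x) x + a * cinner (C x) x) \<le> ?b + ?c"
    using norm_triangle_ineq[of "cinner (B x) x" "a * cinner (C x) x"] assms(3) by (simp add: norm_mult)
  \<comment> \<open>This is the nonnegativity of the square of the difference of the two moduli, and
    the source of the factor \<open>sqrt 2\<close>.\<close>
  also have "\<dots> \<le> sqrt (2 * (?b\<^sup>2 + ?c\<^sup>2))"
    using sum_squares_ge_zero[of "?b - ?c" 0]
    by (intro real_le_rsqrt) (simp add: power2_eq_square algebra_simps)
  also have "\<dots> \<le> sqrt 2 * euclidean_operator_radius B C"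
    using le_euclidean_operator_radius[OF assms(1,2,4)] by (simp only: real_sqrt_mult) simp
  finally show ?thesis .
qed

theorem proposition2p1:
  fixes B C :: "'a::chilbert_space \<Rightarrow> 'a"
  assumes "bounded_clinear B" and "bounded_clinear C"
  shows "euclidean_operator_radius B C \<ge> max (numerical_radius B) (numerical_radius C)
    \<and> (\<forall>\<theta>::real. euclidean_operator_radius B C
           \<ge> 1 / sqrt 2 * numerical_radius (\<lambda>x. B x + exp (\<i> * complex_of_real \<theta>) *\<^sub>C C x))
    \<and> (\<forall>\<theta>::real. euclidean_operator_radius B C
           \<ge> sqrt (1 / 2 * numerical_radius
                       (\<lambda>x. (B ^^ 2) x + exp (\<i> * complex_of_real \<theta>) *\<^sub>C (C ^^ 2) x)
                  + 1 / 2 * \<bar>(numerical_radius B)\<^sup>2 - (numerical_radius C)\<^sup>2\<bar>))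
    \<and> euclidean_operator_radius B C
           \<ge> sqrt (1 / 2 * numerical_radius (\<lambda>x. B (C x) + C (B x)))"
proof -
  let ?w = "euclidean_operator_radius B C"
  let ?b = "numerical_radius B" and ?c = "numerical_radius C"
  note B = assms(1) and C = assms(2)
  have w0: "0 \<le> ?w" and b0: "0 \<le> ?b" and c0: "0 \<le> ?c"
    using B C by (simp_all add: euclidean_operator_radius_nonneg numerical_radius_nonneg)
  have bw: "?b \<le> ?w"
    by (rule numerical_radius_le_euclidean_operator_radius[OF B C])
  have cw: "?c \<le> ?w"
    using numerical_radius_le_euclidean_operator_radius[OF C B]
    by (simp add: euclidean_operator_radius_commute)
  have ii: "1 / sqrt 2 * numerical_radius (\<lambda>x. B x + exp (\<i> * complex_of_real \<theta>) *\<^sub>C C x) \<le> ?w" for \<theta>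
  proof -
    have "numerical_radius (\<lambda>x. B x + exp (\<i> * complex_of_real \<theta>) *\<^sub>C C x) \<le> sqrt 2 * ?w"
      using w0 cmod_cinner_add_le_euclidean_operator_radius[OF B C]
      by (intro numerical_radius_least) (auto simp: cinner_add_left cinner_scaleC_left)
    then show ?thesis
      by (simp add: field_simps)
  qed
  have iii: "sqrt (1 / 2 * numerical_radius (\<lambda>x. (B ^^ 2) x + exp (\<i> * complex_of_real \<theta>) *\<^sub>C (C ^^ 2) x)
               + 1 / 2 * \<bar>?b\<^sup>2 - ?c\<^sup>2\<bar>) \<le> ?w" for \<theta>
  proof -
    have "numerical_radius (\<lambda>x. (B ^^ 2) x + exp (\<i> * complex_of_real \<theta>) *\<^sub>C (C ^^ 2) x) \<le> ?b\<^sup>2 + ?c\<^sup>2"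
    proof (rule numerical_radius_least)
      fix x :: 'a assume x: "norm x = 1"
      \<comment> \<open>The power inequality is applied to B and C separately; the unimodular phase
        then disappears in the triangle inequality.\<close>
      have "cmod (cinner (B (B x)) x) \<le> ?b\<^sup>2" "cmod (cinner (C (C x)) x) \<le> ?c\<^sup>2"
        using B C b0 c0 x by (auto intro!: cmod_cinner_square_le cmod_cinner_le_numerical_radius)
      then show "cmod (cinner ((B ^^ 2) x + exp (\<i> * complex_of_real \<theta>) *\<^sub>C (C ^^ 2) x) x) \<le> ?b\<^sup>2 + ?c\<^sup>2"
        using norm_triangle_ineq[of "cinner (B (B x)) x" "exp (\<i> * complex_of_real \<theta>) * cinner (C (C x)) x"]
        by (simp add: numeral_2_eq_2 cinner_add_left cinner_scaleC_left norm_mult)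
    qed simp
    moreover have "?b\<^sup>2 \<le> ?w\<^sup>2" "?c\<^sup>2 \<le> ?w\<^sup>2"
      using b0 c0 bw cw by (simp_all add: power_mono)
    \<comment> \<open>The radicand is now at most the larger of the squared numerical radii;
      \<open>abs_if\<close> splits according to which one that is.\<close>
    ultimately show ?thesis
      using w0 by (intro real_le_lsqrt) (auto simp: abs_if field_simps)
  qed
  have "numerical_radius (\<lambda>x. B (C x) + C (B x)) \<le> 2 * ?w\<^sup>2"
  proof (rule numerical_radius_least)
    fix x :: 'a assume x: "norm x = 1"
    let ?S = "\<lambda>x. B x + C x" and ?D = "\<lambda>x. B x - C x"
    interpret B: bounded_linear B using B by (simp add: bounded_clinear_def)
    interpret C: bounded_linear C using C by (simp add: bounded_clinear_def)
    \<comment> \<open>The phases 1 and -1 bound the forms of B + C and B - C by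
      \<open>sqrt 2 * ?w\<close>, so their squares have forms bounded by twice the square of
      \<open>?w\<close>.\<close>
    have "cmod (cinner (?S (?S x)) x) \<le> (sqrt 2 * ?w)\<^sup>2"
      using w0 x cmod_cinner_add_le_euclidean_operator_radius[OF B C, of 1]
      by (intro cmod_cinner_square_le[OF bounded_clinear_add[OF B C]]) (auto simp: cinner_add_left)
    moreover have "cmod (cinner (?D (?D x)) x) \<le> (sqrt 2 * ?w)\<^sup>2"
      using w0 x cmod_cinner_add_le_euclidean_operator_radius[OF B C, of "-1"]
      by (intro cmod_cinner_square_le[OF bounded_clinear_diff[OF B C]]) (auto simp: cinner_diff_left)
    \<comment> \<open>In the difference of the two squares, BB and CC cancel and only the mixed
      products survive, each twice.\<close>
    moreover have "2 * cinner (B (C x) + C (B x)) x = cinner (?S (?S x)) x - cinner (?D (?D x)) x"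
      by (simp add: B.add B.diff C.add C.diff cinner_add_left cinner_diff_left)
    then have "2 * cmod (cinner (B (C x) + C (B x)) x)
        \<le> cmod (cinner (?S (?S x)) x) + cmod (cinner (?D (?D x)) x)"
      by (metis norm_mult norm_numeral norm_triangle_ineq4)
    ultimately show "cmod (cinner (B (C x) + C (B x)) x) \<le> 2 * ?w\<^sup>2"
      by (simp add: power_mult_distrib)
  qed simp
  then have iv: "sqrt (1 / 2 * numerical_radius (\<lambda>x. B (C x) + C (B x))) \<le> ?w"
    using w0 by (intro real_le_lsqrt) auto
  from bw cw ii iii iv show ?thesis
    by simp
qed

end
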